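(* Let $G$ be a connected simple graph on $n$ vertices, and let $k$ be a positive even integer with $k \le \operatorname{diam}(G)$. Then \[ q(G) \ge \frac{k n - k^2 Z(G)} {Z^{(k)}_+(G)}. \]
   Context: $\mathcal{S}(G)$ is the set of real symmetric $n\times n$ matrices $A=(a_{ij})$ with $a_{ij}\neq0$ iff $ij\in E(G)$ for $i\ne j$ (diagonal arbitrary); $q(G)$ is the minimum number of distinct eigenvalues of a matrix in $\mathcal{S}(G)$. Zero forcing on a simple graph $H$: an initial set is blue; repeatedly, a blue vertex with exactly one white neighbor forces that neighbor blue; $Z(H)$ is the minimum size of an initial set making all vertices blue. PSD zero forcing: given the current blue set $B$, let $W_1,\ldots,W_m$ be the vertex sets of the components of $H-B$; a blue vertex $u$ may force a white $w\in W_i$ if $w$ is the only white neighbor of $u$ in $H[B\cup W_i]$; $Z_+(H)$ is the minimum size of an initial set making all vertices blue. A lazy walk of length $r$ is a sequence $u_0,\ldots,u_r$ with $u_{t+1}=u_t$ or $u_tu_{t+1}\in E(G)$. $\Gamma(G,k)$ is the multigraph on $V(G)$ with the number of edges between distinct $i,j$ equal to the number of lazy walks from $i$ to $j$ of length at most $k$. An edge configuration of a multigraph $\Gamma$ is a simple graph $H$ on its vertex set such that a pair joined by exactly one edge in $\Gamma$ is an edge of $H$, a pair joined by no edge is not, and a pair joined by two or more edges may or may not be. $Z_+^{(k)}(G)=\max Z_+(H)$ over all edge configurations $H$ of $\Gamma(G,k)$. *)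

theory Defs
  imports "HOL-Analysis.Analysis"
begin

text \<open>A graph whose vertices are the elements of a finite type is given by its adjacency relation.\<close>

definition simple_graph :: "'n rel \<Rightarrow> bool" where
  "simple_graph E \<longleftrightarrow> sym E \<and> irrefl E"

definition connected_graph :: "'n rel \<Rightarrow> bool" where
  "connected_graph E \<longleftrightarrow> E\<^sup>* = UNIV"

definition graph_dist :: "'n rel \<Rightarrow> 'n \<Rightarrow> 'n \<Rightarrow> nat" where
  "graph_dist E u v = (LEAST r. (u, v) \<in> E ^^ r)"

definition diam :: "('n::finite) rel \<Rightarrow> nat" where
  "diam E = Max {graph_dist E u v | u v. True}"

definition sym_matrices :: "('n::finite) rel \<Rightarrow> (real^'n^'n) set" where
  "sym_matrices E =
     {A. transpose A = A \<and> (\<forall>i j. i \<noteq> j \<longrightarrow> (A $ i $ j \<noteq> 0 \<longleftrightarrow> (i, j) \<in> E))}"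

definition eigenvalues :: "real^'n^'n \<Rightarrow> real set" where
  "eigenvalues A = {c. \<exists>v. v \<noteq> 0 \<and> A *v v = c *\<^sub>R v}"

definition min_distinct_eigenvalues :: "('n::finite) rel \<Rightarrow> nat" where
  "min_distinct_eigenvalues E =
     (LEAST m. \<exists>A \<in> sym_matrices E. m = card (eigenvalues A))"

definition force_step :: "'n rel \<Rightarrow> 'n set \<Rightarrow> 'n set \<Rightarrow> bool" where
  "force_step H B B' \<longleftrightarrow> (\<exists>u\<in>B. \<exists>w. H `` {u} - B = {w} \<and> B' = insert w B)"

definition zero_forcing_number :: "('n::finite) rel \<Rightarrow> nat" where
  "zero_forcing_number H = Min (card ` {B. (force_step H)\<^sup>*\<^sup>* B UNIV})"

definition components_minus :: "'n rel \<Rightarrow> 'n set \<Rightarrow> 'n set set" where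
  "components_minus H B = (- B) // (Restr H (- B))\<^sup>*"

definition psd_force_step :: "'n rel \<Rightarrow> 'n set \<Rightarrow> 'n set \<Rightarrow> bool" where
  "psd_force_step H B B' \<longleftrightarrow>
     (\<exists>u\<in>B. \<exists>W \<in> components_minus H B. \<exists>w.
        Restr H (B \<union> W) `` {u} - B = {w} \<and> B' = insert w B)"

definition psd_zero_forcing_number :: "('n::finite) rel \<Rightarrow> nat" where
  "psd_zero_forcing_number H = Min (card ` {B. (psd_force_step H)\<^sup>*\<^sup>* B UNIV})"

text \<open>A walk of length \<open>r\<close> is the list of its \<open>r + 1\<close> vertices.\<close>

definition lazy_walks :: "'n rel \<Rightarrow> nat \<Rightarrow> 'n \<Rightarrow> 'n \<Rightarrow> 'n list set" where
  "lazy_walks E r i j =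
     {us. length us = r + 1 \<and> hd us = i \<and> last us = j \<and>
          successively (\<lambda>x y. y = x \<or> (x, y) \<in> E) us}"

text \<open>A loopless multigraph is given by its edge multiplicities.\<close>

definition walk_multigraph :: "'n rel \<Rightarrow> nat \<Rightarrow> 'n \<Rightarrow> 'n \<Rightarrow> nat" where
  "walk_multigraph E k i j = (if i = j then 0 else card (\<Union>r\<le>k. lazy_walks E r i j))"

definition edge_configuration :: "('n \<Rightarrow> 'n \<Rightarrow> nat) \<Rightarrow> 'n rel \<Rightarrow> bool" where
  "edge_configuration M H \<longleftrightarrow> simple_graph H \<and>
     (\<forall>i j. i \<noteq> j \<longrightarrow> (M i j = 1 \<longrightarrow> (i, j) \<in> H) \<and> (M i j = 0 \<longrightarrow> (i, j) \<notin> H))"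

definition psd_zero_forcing_number_k :: "('n::finite) rel \<Rightarrow> nat \<Rightarrow> nat" where
  "psd_zero_forcing_number_k E k =
     Max (psd_zero_forcing_number ` {H. edge_configuration (walk_multigraph E k) H})"

end

theory Submission
  imports Defs
begin

text \<open>Let \<open>A\<close> attain \<open>q = q(G)\<close>. Choose \<open>k\<close> cyclically consecutive eigenvalues of \<open>A\<close> and let \<open>p\<close>
  be the monic polynomial with these roots. As \<open>k\<close> is even, \<open>p\<close> has constant sign on the rest of the
  spectrum, so \<open>p(A)\<close> or \<open>- p(A)\<close> is positive semidefinite; its graph is an edge configuration of
  \<open>\<Gamma>(G, k)\<close>. Hence the multiplicities of the chosen eigenvalues sum to at most the
  \<open>k\<close>-th PSD zero forcing number \<open>Z\<close> of \<open>G\<close>. Every eigenvalue lies in \<open>k\<close> of the \<open>q\<close> cyclic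
  windows, so \<open>k n \<le> q Z\<close>. This needs \<open>k \<le> q\<close>; for \<open>q < k\<close> the numerator of the bound is
  nonpositive, because each multiplicity is at most the zero forcing number.\<close>

section \<open>Spectral theory of real symmetric matrices\<close>

lemma sum_eq_single:
  fixes f :: "'a::finite \<Rightarrow> 'b::comm_monoid_add"
  assumes "\<And>i. i \<noteq> a \<Longrightarrow> f i = 0"
  shows "(\<Sum>i\<in>UNIV. f i) = f a"
  using assms by (subst sum.remove[of _ a]) (auto intro: sum.neutral)

lemma inner_symmetric_matrix:
  fixes M :: "real^'n^'n"
  assumes "transpose M = M"
  shows "x \<bullet> (M *v y) = (M *v x) \<bullet> y"
  by (metis assms dot_lmul_matrix vector_transpose_matrix)

text \<open>If \<open>z = M *v y\<close> were nonzero, moving from \<open>y\<close> a little way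
  along \<open>- z\<close> would make the form negative. Positivity is asked for only on an
  invariant subspace, since that is all a maximiser of the Rayleigh quotient provides.\<close>

lemma psd_quadratic_form_zero:
  fixes M :: "real^'n^'n"
  assumes "transpose M = M" "subspace V" "\<And>x. x \<in> V \<Longrightarrow> M *v x \<in> V"
    and psd: "\<And>x. x \<in> V \<Longrightarrow> 0 \<le> x \<bullet> (M *v x)"
    and y: "y \<in> V" "y \<bullet> (M *v y) = 0"
  shows "M *v y = 0"
proof (rule ccontr)
  define z where "z = M *v y"
  define a where "a = z \<bullet> z"
  define b where "b = z \<bullet> (M *v z)"
  assume "M *v y \<noteq> 0"
  then have a: "a > 0" by (simp add: a_def z_def)
  have z: "z \<in> V" using assms y by (simp add: z_def)
  then have b: "b \<ge> 0" using psd by (simp add: b_def)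
  \<comment> \<open>Any small positive \<open>t\<close> with \<open>t * b < 2 * a\<close> would do;
    the denominator \<open>b + 1\<close> also covers \<open>b = 0\<close>.\<close>
  define t where "t = a / (b + 1)"
  have "t > 0" "t * (b + 1) = a" using a b by (simp_all add: t_def)
  have 1: "y \<bullet> (M *v z) = a" "z \<bullet> (M *v y) = a"
    using inner_symmetric_matrix[OF assms(1)] by (simp_all add: a_def z_def)
  have "0 \<le> (y - t *\<^sub>R z) \<bullet> (M *v (y - t *\<^sub>R z))"
    using psd assms(2) y z by (simp add: subspace_diff subspace_mul)
  also have "\<dots> = t * (t * b - 2 * a)"
    by (simp add: matrix_vector_mult_diff_distrib inner_diff_left inner_diff_right
        matrix_vector_mult_scaleR 1 y(2) b_def[symmetric] algebra_simps)
  also have "t * b - 2 * a < 0"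
    using \<open>t * (b + 1) = a\<close> \<open>t > 0\<close> a by (simp add: distrib_left)
  finally show False using \<open>t > 0\<close> by (simp add: mult_less_0_iff zero_le_mult_iff)
qed

text \<open>The form attains its maximum \<open>c\<close> on the compact unit sphere of
  \<open>V\<close>. Then \<open>c *\<^sub>R mat 1 - A\<close> is positive semidefinite on
  \<open>V\<close> and its form vanishes at the maximiser, which is therefore an
  eigenvector.\<close>

lemma symmetric_invariant_eigenvector:
  fixes A :: "real^'n^'n"
  assumes sym: "transpose A = A" and V: "subspace V" "V \<noteq> {0}"
    and inv: "\<And>x. x \<in> V \<Longrightarrow> A *v x \<in> V"
  shows "\<exists>v\<in>V. v \<noteq> 0 \<and> (\<exists>c. A *v v = c *\<^sub>R v)"
proof -
  obtain w where w: "w \<in> V" "w \<noteq> 0" using V subspace_0 by blast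
  have "compact (sphere 0 1 \<inter> V)"
    using V by (simp add: closed_subspace compact_Int_closed)
  moreover have "w /\<^sub>R norm w \<in> sphere 0 1 \<inter> V"
    using w V by (simp add: subspace_mul)
  moreover have "continuous_on (sphere 0 1 \<inter> V) (\<lambda>x. x \<bullet> (A *v x))"
    by (intro continuous_intros linear_continuous_on_compose matrix_vector_mul_linear)
  ultimately obtain v where v: "v \<in> sphere 0 1 \<inter> V"
    and max: "\<And>x. x \<in> sphere 0 1 \<inter> V \<Longrightarrow> x \<bullet> (A *v x) \<le> v \<bullet> (A *v v)"
    using continuous_attains_sup[of "sphere 0 1 \<inter> V" "\<lambda>x. x \<bullet> (A *v x)"] by blast
  define c where "c = v \<bullet> (A *v v)"
  define M where "M = c *\<^sub>R mat 1 - A"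
  have Mv: "M *v x = c *\<^sub>R x - A *v x" for x
    by (simp add: M_def matrix_vector_mult_diff_rdistrib scaleR_matrix_vector_assoc[symmetric])
  have "M *v v = 0"
  proof (rule psd_quadratic_form_zero[where V = V])
    show "transpose M = M"
      using sym by (simp add: M_def transpose_def mat_def vec_eq_iff)
    show "0 \<le> x \<bullet> (M *v x)" if "x \<in> V" for x
    proof (cases "x = 0")
      case False
      \<comment> \<open>Homogeneity extends maximality from the sphere to all of
        \<open>V\<close>.\<close>
      have "x /\<^sub>R norm x \<in> sphere 0 1 \<inter> V" using False that V by (simp add: subspace_mul)
      from max[OF this] show ?thesis
        using False by (simp add: Mv c_def inner_diff_right matrix_vector_mult_scaleR
            field_simps dot_square_norm power2_eq_square)
    qed simp
    show "v \<bullet> (M *v v) = 0"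
      using v by (simp add: Mv c_def inner_diff_right dot_square_norm)
  qed (use v V inv in \<open>auto simp: Mv subspace_diff subspace_mul\<close>)
  then show ?thesis using v by (intro bexI[of _ v]) (auto simp: Mv intro: exI[of _ c])
qed

text \<open>An orthogonal family of eigenvectors of largest size must span: its orthogonal
  complement is invariant under \<open>A\<close>, so a nonzero complement would contribute one more
  eigenvector. The multiplicity of an eigenvalue \<open>c\<close> becomes the number of
  \<open>v\<close> in \<open>F\<close> with \<open>mu v = c\<close>.\<close>

lemma symmetric_orthogonal_eigenbasis:
  fixes A :: "real^'n^'n"
  assumes sym: "transpose A = A"
  obtains F mu where "finite F" "0 \<notin> F" "pairwise orthogonal F" "span F = UNIV"
    "card F = CARD('n)" "\<And>v. v \<in> F \<Longrightarrow> A *v v = mu v *\<^sub>R v"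
proof -
  define P where "P F \<longleftrightarrow> 0 \<notin> F \<and> pairwise orthogonal F \<and> (\<forall>v\<in>F. \<exists>c. A *v v = c *\<^sub>R v)"
    for F :: "(real^'n) set"
  have ind: "independent F" if "P F" for F
    using that pairwise_orthogonal_independent by (auto simp: P_def)
  have "P {}" by (simp add: P_def)
  moreover have "\<forall>F. P F \<longrightarrow> card F < Suc CARD('n)"
    using ind independent_bound by (fastforce simp: less_Suc_eq_le)
  ultimately obtain F where F: "P F" and max: "\<And>F'. P F' \<Longrightarrow> card F' \<le> card F"
    using ex_has_greatest_nat[of P "{}" card "Suc CARD('n)"] by auto
  have fin: "finite F" using ind[OF F] by (simp add: independent_imp_finite)
  define V where "V = {x. \<forall>v\<in>F. orthogonal v x}"
  have "V = {0}"
  proof (rule ccontr)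
    assume "V \<noteq> {0}"
    moreover have "subspace V"
      unfolding V_def by (auto simp: subspace_def orthogonal_def inner_add_right)
    moreover have "A *v x \<in> V" if "x \<in> V" for x
      unfolding V_def
    proof safe
      fix v assume v: "v \<in> F"
      obtain c where "A *v v = c *\<^sub>R v" using F v by (auto simp: P_def)
      then show "orthogonal v (A *v x)"
        using that v by (simp add: orthogonal_def V_def inner_symmetric_matrix[OF sym])
    qed
    ultimately obtain w c where w: "w \<in> V" "w \<noteq> 0" "A *v w = c *\<^sub>R w"
      using symmetric_invariant_eigenvector[OF sym] by blast
    then have "P (insert w F)"
      using F by (auto simp: P_def V_def pairwise_insert orthogonal_commute)
    moreover have "w \<notin> F" using w by (auto simp: V_def orthogonal_def)
    ultimately show False using max fin by fastforce
  qed
  have "span F = UNIV"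
  proof (rule ccontr)
    assume "span F \<noteq> UNIV"
    then obtain a where "a \<noteq> 0" "\<forall>x \<in> span F. a \<bullet> x = 0"
      using span_not_UNIV_orthogonal by blast
    then have "a \<in> V" by (auto simp: V_def orthogonal_def span_base inner_commute)
    with \<open>V = {0}\<close> \<open>a \<noteq> 0\<close> show False by simp
  qed
  moreover have "card F = CARD('n)"
    using ind[OF F] \<open>span F = UNIV\<close> dim_eq_card[of F UNIV] by simp
  moreover obtain mu where "\<And>v. v \<in> F \<Longrightarrow> A *v v = mu v *\<^sub>R v"
    using F unfolding P_def by metis
  ultimately show thesis using that[of F mu] F fin by (auto simp: P_def)
qed

text \<open>In coordinates \<open>c\<close> with respect to \<open>F\<close> the form is diagonal,
  with terms \<open>c v * c v * g v * (v \<bullet> v)\<close>.\<close>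

lemma psd_of_orthogonal_eigenbasis:
  fixes M :: "real^'n^'n"
  assumes F: "finite F" "pairwise orthogonal F" "span F = UNIV"
    and M: "\<And>v. v \<in> F \<Longrightarrow> M *v v = g v *\<^sub>R v" "\<And>v. v \<in> F \<Longrightarrow> 0 \<le> g v"
  shows "0 \<le> x \<bullet> (M *v x)"
proof -
  obtain c where x: "x = (\<Sum>v\<in>F. c v *\<^sub>R v)"
    using F span_finite[of F] by (metis (no_types, lifting) UNIV_I imageE)
  have "M *v x = (\<Sum>v\<in>F. (c v * g v) *\<^sub>R v)"
    unfolding x by (simp add: linear_sum[OF matrix_vector_mul_linear] matrix_vector_mult_scaleR M)
  then have "x \<bullet> (M *v x) = (\<Sum>w\<in>F. \<Sum>v\<in>F. c w * c v * g v * (w \<bullet> v))"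
    unfolding x by (simp add: inner_sum_left inner_sum_right sum_distrib_left mult_ac)
      (subst sum.swap, simp add: mult_ac)
  also have "\<dots> = (\<Sum>w\<in>F. \<Sum>v\<in>F. if v = w then c w * c w * g w * (w \<bullet> w) else 0)"
    using F(2) by (intro sum.cong refl) (auto simp: pairwise_def orthogonal_def)
  also have "\<dots> = (\<Sum>w\<in>F. c w * c w * g w * (w \<bullet> w))"
    using F(1) by simp
  also have "\<dots> \<ge> 0"
    using M(2) by (intro sum_nonneg) simp
  finally show ?thesis .
qed

text \<open>Erasing the coordinates outside \<open>B\<close> is linear, injective on
  \<open>S\<close>, and maps into a space of dimension \<open>card B\<close>. Forcing sets will play
  the role of \<open>B\<close>.\<close>

lemma dim_le_card_if_determined:
  fixes S :: "(real^'n) set"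
  assumes S: "subspace S" and det: "\<And>x. x \<in> S \<Longrightarrow> \<forall>i\<in>B. x $ i = 0 \<Longrightarrow> x = 0"
  shows "dim S \<le> card B"
proof -
  define f :: "real^'n \<Rightarrow> real^'n" where "f x = (\<chi> i. if i \<in> B then x $ i else 0)" for x
  have f: "linear f"
    by (rule linearI) (auto simp: f_def vec_eq_iff)
  have "inj_on f (span S)"
  proof (rule inj_onI)
    fix x y assume xy: "x \<in> span S" "y \<in> span S" "f x = f y"
    have "(x - y) $ i = 0" if "i \<in> B" for i
      using arg_cong[OF xy(3), of "\<lambda>z. z $ i"] that by (simp add: f_def)
    then have "\<forall>i\<in>B. (x - y) $ i = 0" by blast
    with det[of "x - y"] xy S show "x = y" by (simp add: span_eq_iff[THEN iffD2] subspace_diff)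
  qed
  then have "dim S = dim (f ` S)" using dim_image_eq[OF f] by simp
  also have "\<dots> \<le> dim {x :: real^'n. \<forall>i. i \<notin> B \<longrightarrow> x $ i = 0}"
    by (rule dim_subset) (auto simp: f_def)
  also have "\<dots> = card B" by (simp only: dim_substandard_cart dim_vec_eq[symmetric])
  finally show ?thesis .
qed


section \<open>Matrix polynomials given by their roots\<close>

text \<open>This is \<open>p(A)\<close> for the monic polynomial \<open>p\<close> with root list
  \<open>cs\<close>. Keeping the factors in a list matches each of them with one step of a lazy
  walk.\<close>

primrec shifted_product :: "real^'n^'n \<Rightarrow> real list \<Rightarrow> real^'n^'n" where
  "shifted_product A [] = mat 1"
| "shifted_product A (c # cs) = (A - c *\<^sub>R mat 1) ** shifted_product A cs"

lemma shifted_product_eigenvector: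
  assumes "A *v v = l *\<^sub>R v"
  shows "shifted_product A cs *v v = (\<Prod>c\<leftarrow>cs. l - c) *\<^sub>R v"
  by (induction cs)
    (simp_all add: assms matrix_vector_mul_assoc[symmetric] matrix_vector_mult_scaleR
      matrix_vector_mult_diff_rdistrib scaleR_matrix_vector_assoc[symmetric] algebra_simps)

text \<open>Transposition reverses the order of the factors; this lemma allows the leading factor to
  return to the front.\<close>

lemma shifted_product_commute:
  fixes A :: "real^'n^'n"
  shows "A ** shifted_product A cs = shifted_product A cs ** A"
proof (induction cs)
  case (Cons c cs)
  have "A ** (A - c *\<^sub>R mat 1) = (A - c *\<^sub>R mat 1) ** A"
    by (simp add: matrix_eq matrix_vector_mul_assoc[symmetric] matrix_vector_mult_diff_rdistrib
        matrix_vector_mult_diff_distrib scaleR_matrix_vector_assoc[symmetric] matrix_vector_mult_scaleR)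
  then show ?case using Cons by (metis matrix_mul_assoc shifted_product.simps(2))
qed simp

lemma transpose_shifted_product:
  fixes A :: "real^'n^'n"
  assumes "transpose A = A"
  shows "transpose (shifted_product A cs) = shifted_product A cs"
proof (induction cs)
  case (Cons c cs)
  have "transpose (A - c *\<^sub>R mat 1) = A - c *\<^sub>R mat 1"
    using assms by (simp add: transpose_def mat_def vec_eq_iff)
  then have "transpose (shifted_product A (c # cs)) = shifted_product A cs ** (A - c *\<^sub>R mat 1)"
    using Cons by (simp add: matrix_transpose_mul)
  also have "\<dots> = shifted_product A (c # cs)"
    using shifted_product_commute[of A cs]
    by (simp add: matrix_eq matrix_vector_mul_assoc[symmetric] matrix_vector_mult_diff_rdistrib
        matrix_vector_mult_diff_distrib scaleR_matrix_vector_assoc[symmetric] matrix_vector_mult_scaleR)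
  finally show ?case .
qed simp

section \<open>Lazy walks and the entries of a matrix polynomial\<close>

lemma Cons_mem_lazy_walks:
  assumes "m = i \<or> (i, m) \<in> E" "us \<in> lazy_walks E k m j"
  shows "i # us \<in> lazy_walks E (Suc k) i j"
  using assms by (cases us) (auto simp: lazy_walks_def)

lemma lazy_walks_SucE:
  assumes "us \<in> lazy_walks E (Suc k) i j"
  obtains m vs where "us = i # vs" "m = i \<or> (i, m) \<in> E" "vs \<in> lazy_walks E k m j"
proof -
  from assms obtain m ws where us: "us = i # m # ws"
    by (cases us; cases "tl us") (auto simp: lazy_walks_def)
  with assms that[of "m # ws" m] show thesis
    by (auto simp: lazy_walks_def)
qed

lemma finite_lazy_walks: "finite (lazy_walks (E :: ('n::finite) rel) k i j)"
  by (rule finite_subset[OF _ finite_lists_length_eq[of UNIV "k + 1"]]) (auto simp: lazy_walks_def)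

text \<open>Expanding the product writes the entry as a sum over lazy walks with one step per
  factor; the diagonal of each factor accounts for waiting. The induction peels off the first
  step.\<close>

lemma shifted_product_entry_eq_0:
  assumes A: "A \<in> sym_matrices E" and "lazy_walks E (length cs) i j = {}"
  shows "shifted_product A cs $ i $ j = 0"
  using assms(2)
proof (induction cs arbitrary: i)
  case Nil
  have "i \<noteq> j"
  proof
    assume "i = j"
    then have "[i] \<in> lazy_walks E (length []) i j" by (simp add: lazy_walks_def)
    with Nil show False by simp
  qed
  then show ?case by (simp add: mat_def)
next
  case (Cons c cs)
  have "(A - c *\<^sub>R mat 1) $ i $ m * shifted_product A cs $ m $ j = 0" for m
  proof (cases "m = i \<or> (i, m) \<in> E")
    case True
    then have "lazy_walks E (length cs) m j = {}"
      using Cons_mem_lazy_walks[of m i E] Cons.prems by fastforce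
    then show ?thesis using Cons.IH by simp
  next
    case False
    then show ?thesis using A by (auto simp: sym_matrices_def mat_def)
  qed
  then show ?case unfolding shifted_product.simps matrix_matrix_mult_def by (simp only: vec_lambda_beta sum.neutral_const)
qed

text \<open>The expansion has a single term. The walk \<open>us\<close> never waits, since dropping
  a wait would leave a walk one step shorter, so the term is a product of off-diagonal entries of
  \<open>A\<close>, which the shifts do not affect. The guard \<open>cs \<noteq> []\<close> is there
  because \<open>0 - 1 = 0\<close> on naturals.\<close>

lemma shifted_product_entry_neq_0:
  assumes A: "A \<in> sym_matrices E"
    and "lazy_walks E (length cs) i j = {us}"
    and "cs \<noteq> [] \<Longrightarrow> lazy_walks E (length cs - 1) i j = {}"
  shows "shifted_product A cs $ i $ j \<noteq> 0"
  using assms(2,3)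
proof (induction cs arbitrary: i us)
  case Nil
  then have "us \<in> lazy_walks E 0 i j" by simp
  then have "i = j" by (cases us) (auto simp: lazy_walks_def)
  then show ?case by (simp add: mat_def)
next
  case (Cons c cs)
  let ?k = "length cs"
  have empty: "lazy_walks E ?k i j = {}" using Cons.prems by simp
  have "us \<in> lazy_walks E (Suc ?k) i j" using Cons.prems by simp
  then obtain m vs where m: "us = i # vs" "m = i \<or> (i, m) \<in> E" "vs \<in> lazy_walks E ?k m j"
    by (rule lazy_walks_SucE)
  then have mi: "m \<noteq> i" "(i, m) \<in> E" using empty by auto
  have only: "vs' = vs" if "m' = i \<or> (i, m') \<in> E" "vs' \<in> lazy_walks E ?k m' j" for m' vs'
    using Cons_mem_lazy_walks[OF that] Cons.prems(1) m(1) by simp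
  have "(A - c *\<^sub>R mat 1) $ i $ m' * shifted_product A cs $ m' $ j = 0" if "m' \<noteq> m" for m'
  proof (cases "m' = i \<or> (i, m') \<in> E")
    case True
    \<comment> \<open>A walk from \<open>m'\<close> would have to equal \<open>vs\<close>, whose
      first vertex is \<open>m\<close>.\<close>
    have "lazy_walks E ?k m' j = {}"
      using only[OF True] m(3) that by (auto simp: lazy_walks_def)
    then show ?thesis using shifted_product_entry_eq_0[OF A] by simp
  next
    case False
    then show ?thesis using A by (auto simp: sym_matrices_def mat_def)
  qed
  then have "shifted_product A (c # cs) $ i $ j =
      (A - c *\<^sub>R mat 1) $ i $ m * shifted_product A cs $ m $ j"
    unfolding shifted_product.simps matrix_matrix_mult_def vec_lambda_beta
    by (rule sum_eq_single)
  moreover have "(A - c *\<^sub>R mat 1) $ i $ m \<noteq> 0"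
    using A mi by (auto simp: sym_matrices_def mat_def)
  moreover have "shifted_product A cs $ m $ j \<noteq> 0"
  proof (rule Cons.IH)
    show "lazy_walks E ?k m j = {vs}" using only m by blast
    show "lazy_walks E (?k - 1) m j = {}" if "cs \<noteq> []"
    proof (rule equals0I)
      \<comment> \<open>Prepending \<open>i\<close> would give a walk excluded by
        \<open>empty\<close>.\<close>
      fix vs' assume "vs' \<in> lazy_walks E (?k - 1) m j"
      from Cons_mem_lazy_walks[OF m(2) this] empty that show False by simp
    qed
  qed
  ultimately show ?case by simp
qed

lemma lazy_walks_pad:
  assumes "lazy_walks E r i j \<noteq> {}" "r \<le> k"
  shows "lazy_walks E k i j \<noteq> {}"
  using assms(2)
proof (induction k rule: dec_induct)
  case (step k)
  then obtain vs where "vs \<in> lazy_walks E k i j" by blast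
  from Cons_mem_lazy_walks[OF disjI1[OF refl] this] show ?case by auto
qed (fact assms(1))

text \<open>A walk shorter than \<open>k\<close> would yield a second one by waiting at the start.\<close>

lemma walk_multigraph_eq_1E:
  assumes "i \<noteq> j" "walk_multigraph E k i j = 1" "0 < k"
  obtains us where "lazy_walks E k i j = {us}" "lazy_walks E (k - 1) i j = {}"
proof -
  let ?W = "\<Union>r\<le>k. lazy_walks E r i j"
  from assms have "card ?W = 1" by (simp add: walk_multigraph_def)
  then obtain us where us: "?W = {us}" by (rule card_1_singletonE)
  have inW: "vs = us" if "vs \<in> lazy_walks E r i j" "r \<le> k" for vs r
  proof -
    have "vs \<in> ?W" using that by blast
    then show ?thesis unfolding us by simp
  qed
  have shorter: "lazy_walks E (k - 1) i j = {}"
  proof (rule equals0I)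
    fix vs assume vs: "vs \<in> lazy_walks E (k - 1) i j"
    then have "i # vs \<in> lazy_walks E k i j"
      using Cons_mem_lazy_walks[OF disjI1[OF refl] vs] \<open>0 < k\<close> by simp
    from inW[OF this] inW[OF vs] show False by simp
  qed
  have "us \<in> ?W" unfolding us by simp
  then obtain r where r: "r \<le> k" "us \<in> lazy_walks E r i j" by blast
  have "r = k"
  proof (rule ccontr)
    assume "r \<noteq> k"
    with r have "r \<le> k - 1" "lazy_walks E r i j \<noteq> {}" by auto
    with lazy_walks_pad[of E r i j "k - 1"] shorter show False by simp
  qed
  with r inW have "lazy_walks E k i j = {us}" by blast
  with shorter that show thesis by blast
qed

lemma walk_multigraph_eq_0D:
  fixes E :: "('n::finite) rel"
  assumes "i \<noteq> j" "walk_multigraph E k i j = 0"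
  shows "lazy_walks E k i j = {}"
proof -
  have "finite (\<Union>r\<le>k. lazy_walks E r i j)" by (simp add: finite_lazy_walks)
  with assms have "(\<Union>r\<le>k. lazy_walks E r i j) = {}" by (simp add: walk_multigraph_def)
  then show ?thesis by blast
qed

text \<open>Multiplicity one means a unique walk of length \<open>k\<close> and none of length
  \<open>k - 1\<close>, so the entry is nonzero; multiplicity zero forces a zero entry. With two or
  more walks terms may cancel, which is exactly the freedom of an edge configuration.\<close>

lemma edge_configuration_shifted_product:
  fixes E :: "('n::finite) rel"
  assumes A: "A \<in> sym_matrices E" and k: "length cs = k" "0 < k"
  shows "edge_configuration (walk_multigraph E k)
    {(i, j). i \<noteq> j \<and> shifted_product A cs $ i $ j \<noteq> 0}" (is "edge_configuration _ ?H")
proof -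
  let ?P = "shifted_product A cs"
  have sym: "transpose ?P = ?P"
    using A by (intro transpose_shifted_product) (simp add: sym_matrices_def)
  have symP: "?P $ i $ j = ?P $ j $ i" for i j
    using arg_cong[OF sym, of "\<lambda>M. M $ j $ i"] by (simp add: transpose_def)
  have "?P $ i $ j \<noteq> 0" if ij: "i \<noteq> j" "walk_multigraph E k i j = 1" for i j
  proof -
    obtain us where "lazy_walks E k i j = {us}" "lazy_walks E (k - 1) i j = {}"
      using walk_multigraph_eq_1E[OF ij k(2)] .
    then show ?thesis using shifted_product_entry_neq_0[OF A, of cs i j us] k by simp
  qed
  moreover have "?P $ i $ j = 0" if "i \<noteq> j" "walk_multigraph E k i j = 0" for i j
    using shifted_product_entry_eq_0[OF A] walk_multigraph_eq_0D[OF that] k by simp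
  moreover have "simple_graph ?H"
    unfolding simple_graph_def
  proof
    show "sym ?H"
    proof (rule symI)
      fix i j assume "(i, j) \<in> ?H"
      then show "(j, i) \<in> ?H" using symP[of i j] by auto
    qed
  qed (simp add: irrefl_def)
  ultimately show ?thesis
    unfolding edge_configuration_def by simp
qed

section \<open>Zero forcing as propagation of zero coordinates\<close>

text \<open>In the row of a forcing vertex \<open>u\<close>, every term vanishes except
  \<open>A $ u $ w * x $ w\<close>, and the right-hand side is zero because
  \<open>x $ u = 0\<close>. So each force carries the zero over to \<open>w\<close>.\<close>

lemma zero_forcing_kernel:
  fixes A :: "real^'n^'n"
  assumes A: "A \<in> sym_matrices E" and x: "A *v x = c *\<^sub>R x"
    and "(force_step E)\<^sup>*\<^sup>* B B'" and "\<forall>i\<in>B. x $ i = 0"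
  shows "\<forall>i\<in>B'. x $ i = 0"
  using assms(3,4)
proof (induction rule: rtranclp_induct)
  case (step C C')
  then have C: "\<forall>i\<in>C. x $ i = 0" by simp
  from step(2) obtain u w where u: "u \<in> C" "E `` {u} - C = {w}" and C': "C' = insert w C"
    by (auto simp: force_step_def)
  have "A $ u $ j * x $ j = 0" if "j \<noteq> w" for j
    proof (cases "j \<in> C")
    case False
    with u that have "(u, j) \<notin> E" "u \<noteq> j" by auto
    with A show ?thesis by (auto simp: sym_matrices_def)
  qed (use C in simp)
  then have "(A *v x) $ u = A $ u $ w * x $ w"
    unfolding matrix_vector_mult_def vec_lambda_beta by (rule sum_eq_single)
  moreover have "A $ u $ w \<noteq> 0" using A u by (auto simp: sym_matrices_def)
  ultimately show ?case using x C u C' by auto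
qed simp

text \<open>The restriction \<open>y\<close> of a kernel vector to a white component has vanishing quadratic form,
  hence is in the kernel itself, and the forcing row of \<open>M *v y = 0\<close> has a single term.\<close>

lemma psd_zero_forcing_kernel:
  fixes M :: "real^'n^'n"
  assumes M: "M \<in> sym_matrices H" and psd: "\<And>x. 0 \<le> x \<bullet> (M *v x)" and x: "M *v x = 0"
    and "(psd_force_step H)\<^sup>*\<^sup>* B B'" and "\<forall>i\<in>B. x $ i = 0"
  shows "\<forall>i\<in>B'. x $ i = 0"
  using assms(4,5)
proof (induction rule: rtranclp_induct)
  case (step C C')
  then have C: "\<forall>i\<in>C. x $ i = 0" by simp
  from step(2) obtain u W w where u: "u \<in> C" and W: "W \<in> components_minus H C"
    and w: "Restr H (C \<union> W) `` {u} - C = {w}" and C': "C' = insert w C"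
    by (auto simp: psd_force_step_def)
  have WC: "W \<inter> C = {}" and closed: "\<And>i j. i \<in> W \<Longrightarrow> (i, j) \<in> H \<Longrightarrow> j \<notin> C \<Longrightarrow> j \<in> W"
  proof -
    from W obtain a where a: "a \<notin> C" "W = (Restr H (- C))\<^sup>* `` {a}"
      unfolding components_minus_def by (auto elim: quotientE)
    have "b \<notin> C" if "(a, b) \<in> (Restr H (- C))\<^sup>*" for b
      using that a(1) by (induction rule: rtrancl_induct) auto
    then show WC: "W \<inter> C = {}" using a by auto
    show "j \<in> W" if "i \<in> W" "(i, j) \<in> H" "j \<notin> C" for i j
      using that a WC by (auto intro: rtrancl_into_rtrancl)
  qed
  define y :: "real^'n" where "y = (\<chi> i. if i \<in> W then x $ i else 0)"
  have "(M *v y) $ i = (M *v x) $ i" if "i \<in> W" for i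
  proof -
    have "M $ i $ j * y $ j = M $ i $ j * x $ j" for j
      proof (cases "j \<in> W \<or> j \<in> C")
      case False
      with closed[OF that, of j] that have "(i, j) \<notin> H" "i \<noteq> j" by auto
      with M show ?thesis by (auto simp: sym_matrices_def)
    qed (use C WC in \<open>auto simp: y_def\<close>)
    then show ?thesis unfolding matrix_vector_mult_def vec_lambda_beta by (rule sum.cong[OF refl])
  qed
  then have "y $ i * (M *v y) $ i = 0" for i
    by (cases "i \<in> W") (simp_all add: x y_def)
  then have "y \<bullet> (M *v y) = 0" unfolding inner_vec_def inner_real_def by (simp only: sum.neutral_const)
  with M psd have "M *v y = 0"
    using psd_quadratic_form_zero[of M UNIV y] by (simp add: sym_matrices_def)
  have "M $ u $ j * y $ j = 0" if "j \<noteq> w" for j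
  proof (cases "j \<in> W")
    case True
    with u w WC that have "(u, j) \<notin> H" "u \<noteq> j" by auto
    with M show ?thesis by (auto simp: sym_matrices_def)
  qed (simp add: y_def)
  then have "(M *v y) $ u = M $ u $ w * y $ w"
    unfolding matrix_vector_mult_def vec_lambda_beta by (rule sum_eq_single)
  moreover have "M $ u $ w \<noteq> 0" using M u w by (auto simp: sym_matrices_def)
  moreover have "y $ w = x $ w" using w by (auto simp: y_def)
  ultimately show ?case using \<open>M *v y = 0\<close> C C' by auto
qed simp

text \<open>The minimum is attained because \<open>UNIV\<close> forces itself. A general relation
  \<open>R\<close> serves both forcing numbers.\<close>

lemma Min_card_forcing_setE:
  fixes R :: "('n::finite) set \<Rightarrow> 'n set \<Rightarrow> bool"
  obtains B where "R\<^sup>*\<^sup>* B UNIV" "Min (card ` {B. R\<^sup>*\<^sup>* B UNIV}) = card B"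
proof -
  have "UNIV \<in> {B. R\<^sup>*\<^sup>* B UNIV}" by simp
  then have "Min (card ` {B. R\<^sup>*\<^sup>* B UNIV}) \<in> card ` {B. R\<^sup>*\<^sup>* B UNIV}"
    by (intro Min_in) (simp_all only: finite finite_imageI image_is_empty, blast)
  with that show thesis by blast
qed

text \<open>An eigenvector that vanishes on a forcing set vanishes everywhere.\<close>

lemma eigenspace_dim_le_zero_forcing_number:
  fixes A :: "real^'n^'n"
  assumes "A \<in> sym_matrices E"
  shows "dim {x. A *v x = c *\<^sub>R x} \<le> zero_forcing_number E"
proof -
  obtain B where B: "(force_step E)\<^sup>*\<^sup>* B UNIV" "zero_forcing_number E = card B"
    unfolding zero_forcing_number_def by (rule Min_card_forcing_setE)
  have "subspace {x. A *v x = c *\<^sub>R x}"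
    by (simp add: subspace_def matrix_vector_right_distrib matrix_vector_mult_scaleR
        scaleR_add_right mult.commute)
  then have "dim {x. A *v x = c *\<^sub>R x} \<le> card B"
  proof (rule dim_le_card_if_determined)
    fix x assume x: "x \<in> {x. A *v x = c *\<^sub>R x}" "\<forall>i\<in>B. x $ i = 0"
    then have "\<forall>i\<in>UNIV. x $ i = 0"
      by (intro zero_forcing_kernel[OF assms _ B(1), of x c]) simp_all
    then show "x = 0" by (simp add: vec_eq_iff)
  qed
  with B show ?thesis by simp
qed

lemma psd_kernel_dim_le_psd_zero_forcing_number:
  fixes M :: "real^'n^'n"
  assumes "M \<in> sym_matrices H" "\<And>x. 0 \<le> x \<bullet> (M *v x)"
  shows "dim {x. M *v x = 0} \<le> psd_zero_forcing_number H"
proof -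
  obtain B where B: "(psd_force_step H)\<^sup>*\<^sup>* B UNIV" "psd_zero_forcing_number H = card B"
    unfolding psd_zero_forcing_number_def by (rule Min_card_forcing_setE)
  have "subspace {x. M *v x = 0}"
    by (simp add: subspace_def matrix_vector_right_distrib matrix_vector_mult_scaleR)
  then have "dim {x. M *v x = 0} \<le> card B"
  proof (rule dim_le_card_if_determined)
    fix x assume x: "x \<in> {x. M *v x = 0}" "\<forall>i\<in>B. x $ i = 0"
    then have "\<forall>i\<in>UNIV. x $ i = 0"
      by (intro psd_zero_forcing_kernel[OF assms _ B(1)]) simp_all
    then show "x = 0" by (simp add: vec_eq_iff)
  qed
  with B show ?thesis by simp
qed

section \<open>Cyclic windows of eigenvalues\<close>

text \<open>If the window wraps around, \<open>(- 1) ^ (q - i)\<close> is the sign of the product at every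
  eigenvalue outside it, since \<open>q - i\<close> elements of the window lie above and the others below.\<close>

lemma cyclic_window_semidefinite:
  fixes lam :: "nat \<Rightarrow> real"
  assumes mono: "\<And>i j. i < j \<Longrightarrow> j < q \<Longrightarrow> lam i < lam j"
    and k: "even k" "k \<le> q" and i: "i < q"
  shows "\<exists>s::real. s \<noteq> 0 \<and> (\<forall>m<q. 0 \<le> s * (\<Prod>t<k. lam m - lam ((i + t) mod q)))"
proof (cases "i + k \<le> q")
  case True
  have "0 \<le> 1 * (\<Prod>t<k. lam m - lam ((i + t) mod q))" if m: "m < q" for m
  proof -
    have eq: "(\<Prod>t<k. lam m - lam ((i + t) mod q)) = (\<Prod>t<k. lam m - lam (i + t))"
      using True by (intro prod.cong) auto
    consider "m < i" | "i \<le> m" "m < i + k" | "i + k \<le> m" by linarith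
    then have "0 \<le> (\<Prod>t<k. lam m - lam (i + t))"
    proof cases
      case 1
      \<comment> \<open>Below the window all \<open>k\<close> factors are negative, and
        \<open>k\<close> is even.\<close>
      have "(\<Prod>t<k. lam m - lam (i + t)) = (\<Prod>t<k. - (lam (i + t) - lam m))" by simp
      also have "\<dots> = (\<Prod>t<k. lam (i + t) - lam m)"
        using k(1) by (simp only: prod_uminus card_lessThan) simp
      also have "\<dots> \<ge> 0"
        using 1 True by (intro prod_nonneg) (auto intro!: less_imp_le mono)
      finally show ?thesis .
    next
      case 2
      then have "(\<Prod>t<k. lam m - lam (i + t)) = 0"
        by (intro prod_zero) (auto intro!: bexI[of _ "m - i"])
      then show ?thesis by (simp only: order_refl)
    next
      case 3
      then show ?thesis using m by (intro prod_nonneg) (auto intro!: less_imp_le mono)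
    qed
    then show ?thesis by (simp only: eq mult_1)
  qed
  then show ?thesis by (intro exI[of _ 1]) simp
next
  case False
  define a where "a = q - i"
  have a: "a < k" "i + a = q" using False i by (auto simp: a_def)
  have "0 \<le> (- 1) ^ a * (\<Prod>t<k. lam m - lam ((i + t) mod q))" if m: "m < q" for m
  proof -
    have "(\<Prod>t<k. lam m - lam ((i + t) mod q)) =
      (\<Prod>t<a. lam m - lam ((i + t) mod q)) * (\<Prod>t=a..<k. lam m - lam ((i + t) mod q))"
      using a(1) by (subst prod.union_disjoint[symmetric]) (auto intro!: prod.cong)
    also have "(\<Prod>t<a. lam m - lam ((i + t) mod q)) = (\<Prod>t<a. - (lam (i + t) - lam m))"
      using a by (intro prod.cong) auto
    also have "\<dots> = (- 1) ^ a * (\<Prod>t<a. lam (i + t) - lam m)"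
      by (simp only: prod_uminus card_lessThan)
    also have "(\<Prod>t=a..<k. lam m - lam ((i + t) mod q)) = (\<Prod>t=a..<k. lam m - lam (i + t - q))"
      using a k i by (intro prod.cong refl) (auto simp: mod_if)
    finally have eq: "(- 1) ^ a * (\<Prod>t<k. lam m - lam ((i + t) mod q)) =
      (\<Prod>t<a. lam (i + t) - lam m) * (\<Prod>t=a..<k. lam m - lam (i + t - q))"
      by (simp add: mult.assoc[symmetric] power_add[symmetric])
    \<comment> \<open>The top segment of the window, its wrapped bottom segment, and the gap between
      them. On the segments a factor is zero, at offset \<open>m - i\<close> or
      \<open>m + q - i\<close>.\<close>
    consider "i \<le> m" | "m < i" "m < i + k - q" | "m < i" "i + k - q \<le> m" by linarith
    then show ?thesis
    proof cases
      case 1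
      then have "(\<Prod>t<a. lam (i + t) - lam m) = 0"
        using m a by (intro prod_zero) (auto intro!: bexI[of _ "m - i"])
      then show ?thesis by (simp only: eq mult_zero_left mult_zero_right order_refl)
    next
      case 2
      then have "(\<Prod>t=a..<k. lam m - lam (i + t - q)) = 0"
        using m a by (intro prod_zero) (auto intro!: bexI[of _ "m + q - i"])
      then show ?thesis by (simp only: eq mult_zero_left mult_zero_right order_refl)
    next
      case 3
      then show ?thesis
        unfolding eq using m a
        by (intro mult_nonneg_nonneg prod_nonneg) (auto intro!: less_imp_le mono)
    qed
  qed
  then show ?thesis by (intro exI[of _ "(- 1) ^ a"]) simp
qed

text \<open>Each offset \<open>t < k\<close> determines a start whose window has \<open>m\<close> at
  that offset; since \<open>k \<le> q\<close>, different offsets give different starts.\<close>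

lemma card_cyclic_windows_containing:
  fixes k m q :: nat
  assumes "m < q" "k \<le> q"
  shows "k \<le> card {i \<in> {..<q}. \<exists>t<k. (i + t) mod q = m}"
proof -
  \<comment> \<open>This is \<open>m - t\<close> modulo \<open>q\<close>, arranged so that
    subtraction on naturals does not truncate.\<close>
  let ?f = "\<lambda>t. (m + (q - t)) mod q"
  have f: "(?f t + t) mod q = m" if "t < k" for t
    using that assms by (simp add: mod_add_left_eq)
  have "inj_on ?f {..<k}"
  proof (rule linorder_inj_onI')
    fix t t' assume t: "t \<in> {..<k}" "t' \<in> {..<k}" "t < t'"
    show "?f t \<noteq> ?f t'"
    proof
      assume eq: "?f t = ?f t'"
      have "(?f t' + t') mod q = (?f t + t) mod q"
        using t by (simp only: f lessThan_iff)
      then have "(?f t + t') mod q = (?f t + t) mod q" by (simp only: eq)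
      then have "q dvd t' - t"
        using mod_eq_dvd_iff_nat[of "?f t + t" "?f t + t'" q] t by simp
      then show False using t assms by (auto dest: dvd_imp_le)
    qed
  qed
  moreover have "?f ` {..<k} \<subseteq> {i \<in> {..<q}. \<exists>t<k. (i + t) mod q = m}"
  proof (rule image_subsetI)
    fix t assume "t \<in> {..<k}"
    then show "?f t \<in> {i \<in> {..<q}. \<exists>t<k. (i + t) mod q = m}"
      using f[of t] assms(1) by (intro CollectI conjI exI[of _ t]) simp_all
  qed
  ultimately show ?thesis
    using card_inj_on_le[of ?f "{..<k}"] by simp
qed

section \<open>Multiplicity bounds and double counting\<close>

text \<open>The scalar \<open>s\<close> corrects the sign of \<open>p(A)\<close> and, being nonzero,
  preserves its graph \<open>H\<close>. The selected eigenvectors are independent members of the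
  kernel, whose dimension is bounded by PSD forcing on \<open>H\<close>.\<close>

lemma psd_zero_forcing_number_k_ge:
  fixes E :: "('n::finite) rel"
  assumes A: "A \<in> sym_matrices E"
    and F: "finite F" "0 \<notin> F" "pairwise orthogonal F" "span F = UNIV"
    and mu: "\<And>v. v \<in> F \<Longrightarrow> A *v v = mu v *\<^sub>R v"
    and k: "length cs = k" "0 < k"
    and s: "s \<noteq> 0" "\<And>v. v \<in> F \<Longrightarrow> 0 \<le> s * (\<Prod>c\<leftarrow>cs. mu v - c)"
  shows "card {v \<in> F. mu v \<in> set cs} \<le> psd_zero_forcing_number_k E k"
proof -
  let ?P = "shifted_product A cs"
  define H where "H = {(i, j). i \<noteq> j \<and> ?P $ i $ j \<noteq> 0}"
  define M where "M = s *\<^sub>R ?P"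
  have H: "edge_configuration (walk_multigraph E k) H"
    unfolding H_def by (rule edge_configuration_shifted_product[OF A k])
  have "transpose ?P = ?P"
    using A by (intro transpose_shifted_product) (simp add: sym_matrices_def)
  then have M: "M \<in> sym_matrices H"
    using s(1) by (simp add: sym_matrices_def M_def H_def transpose_scalar)
  have Mv: "M *v v = (s * (\<Prod>c\<leftarrow>cs. mu v - c)) *\<^sub>R v" if "v \<in> F" for v
    using shifted_product_eigenvector[OF mu[OF that]]
    by (simp add: M_def scaleR_matrix_vector_assoc[symmetric])
  have psd: "0 \<le> x \<bullet> (M *v x)" for x
    using psd_of_orthogonal_eigenbasis[OF F(1,3,4) Mv s(2)] .
  have "independent {v \<in> F. mu v \<in> set cs}"
    using pairwise_orthogonal_independent[OF F(3,2)] by (rule independent_mono) auto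
  moreover have "M *v v = 0" if "v \<in> F" "mu v \<in> set cs" for v
  proof -
    have "(\<Prod>c\<leftarrow>cs. mu v - c) = 0" using that(2) by (auto simp: prod_list_zero_iff)
    then show ?thesis using Mv[OF that(1)] by simp
  qed
  ultimately have "card {v \<in> F. mu v \<in> set cs} \<le> dim {x. M *v x = 0}"
    by (intro independent_card_le_dim) auto
  also have "\<dots> \<le> psd_zero_forcing_number H"
    by (rule psd_kernel_dim_le_psd_zero_forcing_number[OF M psd])
  also have "\<dots> \<le> psd_zero_forcing_number_k E k"
    unfolding psd_zero_forcing_number_k_def using H by (intro Max_ge) auto
  finally show ?thesis .
qed

text \<open>An eigenvector \<open>x\<close> for \<open>c\<close> is not orthogonal to all of the
  spanning set \<open>F\<close>. Pairing it with a suitable \<open>v\<close> and moving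
  \<open>A\<close> across the inner product gives \<open>c = mu v\<close>.\<close>

lemma eigenvalues_eq_image_eigenbasis:
  fixes A :: "real^'n^'n"
  assumes A: "transpose A = A" and F: "0 \<notin> F" "span F = UNIV"
    and mu: "\<And>v. v \<in> F \<Longrightarrow> A *v v = mu v *\<^sub>R v"
  shows "eigenvalues A = mu ` F"
proof
  show "mu ` F \<subseteq> eigenvalues A"
  proof
    fix c assume "c \<in> mu ` F"
    then obtain v where "v \<in> F" "c = mu v" by blast
    moreover from this F(1) have "v \<noteq> 0" by metis
    ultimately show "c \<in> eigenvalues A" using mu[of v] by (auto simp: eigenvalues_def)
  qed
  show "eigenvalues A \<subseteq> mu ` F"
  proof
    fix c assume "c \<in> eigenvalues A"
    then obtain x where x: "x \<noteq> 0" "A *v x = c *\<^sub>R x" by (auto simp: eigenvalues_def)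
    have "\<exists>v\<in>F. v \<bullet> x \<noteq> 0"
    proof (rule ccontr)
      assume "\<not> (\<exists>v\<in>F. v \<bullet> x \<noteq> 0)"
      then have "orthogonal x x"
        by (intro orthogonal_to_span[of x F]) (simp_all add: F(2) orthogonal_def inner_commute)
      with x show False by (simp add: orthogonal_def)
    qed
    then obtain v where v: "v \<in> F" "v \<bullet> x \<noteq> 0" by blast
    have "c * (v \<bullet> x) = mu v * (v \<bullet> x)"
      using inner_symmetric_matrix[OF A, of v x] by (simp add: x(2) mu[OF v(1)])
    then show "c \<in> mu ` F" using v by simp
  qed
qed

text \<open>The order of the graph is the sum of the multiplicities, each at most the zero forcing
  number.\<close>

lemma card_eigenvalues_ge_zero_forcing:
  fixes E :: "('n::finite) rel"
  assumes A: "A \<in> sym_matrices E"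
  shows "CARD('n) \<le> card (eigenvalues A) * zero_forcing_number E"
proof -
  have sym: "transpose A = A" using A by (simp add: sym_matrices_def)
  obtain F mu where F: "finite F" "0 \<notin> F" "pairwise orthogonal F" "span F = UNIV"
    "card F = CARD('n)" and mu: "\<And>v. v \<in> F \<Longrightarrow> A *v v = mu v *\<^sub>R v"
    using symmetric_orthogonal_eigenbasis[OF sym] by metis
  have "card {v \<in> F. mu v = c} \<le> zero_forcing_number E" for c
  proof -
    have "independent {v \<in> F. mu v = c}"
      using pairwise_orthogonal_independent[OF F(3,2)] by (rule independent_mono) auto
    then have "card {v \<in> F. mu v = c} \<le> dim {x. A *v x = c *\<^sub>R x}"
      using mu by (intro independent_card_le_dim) auto
    with eigenspace_dim_le_zero_forcing_number[OF A] show ?thesis by (rule order_trans[rotated])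
  qed
  then have "(\<Sum>c\<in>mu ` F. card {v \<in> F. mu v = c}) \<le> card (mu ` F) * zero_forcing_number E"
    using sum_bounded_above[of "mu ` F" "\<lambda>c. card {v \<in> F. mu v = c}"] by simp
  moreover have "card F = (\<Sum>c\<in>mu ` F. card {v \<in> F. mu v = c})"
    using sum.image_gen[OF F(1), of "\<lambda>_. 1::nat" mu] by simp
  ultimately show ?thesis
    using F(5) eigenvalues_eq_image_eigenbasis[OF sym F(2,4) mu] by simp
qed

text \<open>Pairs of a basis vector \<open>v\<close> and a window start \<open>i\<close> with
  \<open>mu v\<close> in the window are counted in two ways. Counting vectors instead of eigenvalues
  builds in the multiplicities.\<close>

lemma card_eigenvalues_ge_psd_zero_forcing:
  fixes E :: "('n::finite) rel"
  assumes A: "A \<in> sym_matrices E" and k: "0 < k" "even k" "k \<le> card (eigenvalues A)"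
  shows "k * CARD('n) \<le> card (eigenvalues A) * psd_zero_forcing_number_k E k"
proof -
  have sym: "transpose A = A" using A by (simp add: sym_matrices_def)
  obtain F mu where F: "finite F" "0 \<notin> F" "pairwise orthogonal F" "span F = UNIV"
    "card F = CARD('n)" and mu: "\<And>v. v \<in> F \<Longrightarrow> A *v v = mu v *\<^sub>R v"
    using symmetric_orthogonal_eigenbasis[OF sym] by metis
  have spec: "eigenvalues A = mu ` F"
    by (rule eigenvalues_eq_image_eigenbasis[OF sym F(2,4) mu])
  define q where "q = card (mu ` F)"
  define lam where "lam i = sorted_list_of_set (mu ` F) ! i" for i
  have len: "length (sorted_list_of_set (mu ` F)) = q" by (simp add: q_def)
  have mono: "lam i < lam j" if "i < j" "j < q" for i j
    unfolding lam_def using that len by (intro sorted_wrt_nth_less[of "(<)"]) auto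
  have ex: "\<exists>m<q. mu v = lam m" if "v \<in> F" for v
  proof -
    have "mu v \<in> set (sorted_list_of_set (mu ` F))" using that F(1) by simp
    then show ?thesis unfolding in_set_conv_nth len lam_def by auto
  qed
  have kq: "k \<le> q" using k(3) spec by (simp add: q_def)
  define W where "W i = map (\<lambda>t. lam ((i + t) mod q)) [0..<k]" for i
  have window: "card {v \<in> F. mu v \<in> set (W i)} \<le> psd_zero_forcing_number_k E k" if i: "i < q" for i
  proof -
    have prodW: "(\<Prod>c\<leftarrow>W i. x - c) = (\<Prod>t<k. x - lam ((i + t) mod q))" for x
      using prod.distinct_set_conv_list[of "[0..<k]" "\<lambda>t. x - lam ((i + t) mod q)"]
      by (simp add: W_def comp_def atLeast0LessThan)
    obtain s :: real where s: "s \<noteq> 0"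
      "\<forall>m<q. 0 \<le> s * (\<Prod>t<k. lam m - lam ((i + t) mod q))"
      using cyclic_window_semidefinite[of q lam k i, OF mono k(2) kq i] by blast
    show ?thesis
    proof (rule psd_zero_forcing_number_k_ge[OF A F(1-4) mu _ k(1) s(1)])
      show "length (W i) = k" by (simp add: W_def)
      show "0 \<le> s * (\<Prod>c\<leftarrow>W i. mu v - c)" if "v \<in> F" for v
      proof -
        obtain m where m: "m < q" "mu v = lam m" using ex[OF \<open>v \<in> F\<close>] by blast
        show ?thesis unfolding prodW m(2) by (rule s(2)[rule_format, OF m(1)])
      qed
    qed
  qed
  have "k \<le> card {i \<in> {..<q}. mu v \<in> set (W i)}" if "v \<in> F" for v
  proof -
    obtain m where m: "m < q" "mu v = lam m" using ex[OF \<open>v \<in> F\<close>] by blast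
    have "{i \<in> {..<q}. \<exists>t<k. (i + t) mod q = m} \<subseteq> {i \<in> {..<q}. mu v \<in> set (W i)}"
      using m by (auto simp: W_def)
    then have "card {i \<in> {..<q}. \<exists>t<k. (i + t) mod q = m} \<le> card {i \<in> {..<q}. mu v \<in> set (W i)}"
      by (intro card_mono) simp_all
    with card_cyclic_windows_containing[OF m(1) kq] show ?thesis by (rule order_trans)
  qed
  then have "k * card F \<le> (\<Sum>v\<in>F. card {i \<in> {..<q}. mu v \<in> set (W i)})"
    using sum_bounded_below[of F k] by (simp add: mult.commute)
  \<comment> \<open>Cardinalities become sums of indicators, whose order is exchanged.\<close>
  also have "\<dots> = (\<Sum>i\<in>{..<q}. card {v \<in> F. mu v \<in> set (W i)})"
    unfolding card_eq_sum sum.inter_filter[OF F(1)] sum.inter_filter[OF finite_lessThan]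
    by (rule sum.swap)
  also have "\<dots> \<le> q * psd_zero_forcing_number_k E k"
    using sum_bounded_above[of "{..<q}" "\<lambda>i. card {v \<in> F. mu v \<in> set (W i)}"] window by simp
  finally show ?thesis by (simp add: F(5) spec q_def)
qed

text \<open>The adjacency matrix shows that the least value ranges over a nonempty set.\<close>

lemma min_distinct_eigenvalues_attained:
  fixes E :: "('n::finite) rel"
  assumes "simple_graph E"
  obtains A where "A \<in> sym_matrices E" "min_distinct_eigenvalues E = card (eigenvalues A)"
proof -
  have "(\<chi> i j. if (i, j) \<in> E then 1 else 0) \<in> sym_matrices E"
    using assms by (auto simp: sym_matrices_def transpose_def vec_eq_iff simple_graph_def dest: symD)
  then have "\<exists>m. \<exists>A \<in> sym_matrices E. m = card (eigenvalues A)" by blast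
  from LeastI_ex[OF this] show thesis
    using that unfolding min_distinct_eigenvalues_def by blast
qed

theorem mainTheorem13:
  fixes E :: "('n::finite) rel" and k :: nat
  assumes "simple_graph E" and "connected_graph E"
    and "0 < k" and "even k" and "k \<le> diam E"
  shows "real (min_distinct_eigenvalues E) \<ge>
    (real k * real CARD('n) - (real k)\<^sup>2 * real (zero_forcing_number E)) /
      real (psd_zero_forcing_number_k E k)"
proof -
  let ?n = "CARD('n)" and ?Z = "zero_forcing_number E" and ?Zk = "psd_zero_forcing_number_k E k"
  obtain A where A: "A \<in> sym_matrices E" "min_distinct_eigenvalues E = card (eigenvalues A)"
    using min_distinct_eigenvalues_attained[OF assms(1)] .
  define q where "q = card (eigenvalues A)"
  have "(real k * real ?n - (real k)\<^sup>2 * real ?Z) / real ?Zk \<le> real q"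
  proof (cases "k \<le> q")
    case True
    then have "k * ?n \<le> q * ?Zk"
      using card_eigenvalues_ge_psd_zero_forcing[OF A(1)] assms(3,4) by (simp add: q_def)
    then have "real k * real ?n \<le> real q * real ?Zk"
      by (metis of_nat_le_iff of_nat_mult)
    moreover have "0 \<le> (real k)\<^sup>2 * real ?Z" by simp
    ultimately have "real k * real ?n - (real k)\<^sup>2 * real ?Z \<le> real q * real ?Zk" by linarith
    \<comment> \<open>For \<open>?Zk = 0\<close> the quotient is \<open>0\<close> by convention, and
      the bound is trivial.\<close>
    then show ?thesis by (cases "?Zk = 0") (simp_all add: pos_divide_le_eq)
  next
    case False
    have "?n \<le> q * ?Z"
      using card_eigenvalues_ge_zero_forcing[OF A(1)] by (simp add: q_def)
    also have "\<dots> \<le> k * ?Z" using False by simp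
    finally have "k * ?n \<le> k * (k * ?Z)" by simp
    then have "real (k * ?n) \<le> real (k * (k * ?Z))" by (rule of_nat_mono)
    then have "real k * real ?n - (real k)\<^sup>2 * real ?Z \<le> 0"
      by (simp add: power2_eq_square mult.assoc)
    then have "(real k * real ?n - (real k)\<^sup>2 * real ?Z) / real ?Zk \<le> 0"
      by (simp add: divide_nonpos_nonneg)
    then show ?thesis by (rule order_trans) simp
  qed
  then show ?thesis by (simp add: A(2) q_def)
qed

end
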